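(* (i) Let $G$ and $H$ be bipartite graphs with bipartitions $(A_G,B_G)$ and $(A_H,B_H)$, respectively, such that $H$ is a bipartite cover of $G$ with respect to some $L: A_G\to 2^{A_H},\ B_G\to 2^{B_H}$ and such that the following holds: the maximum degree of $H$ is $D$, $|L(v)| \ge 2D^2$ for all $v\in A_G$, $|L(w)|=2$ for all $w\in B_G$, and there is no $w\in B_G$ for which some vertex of $A_H$ is adjacent to both vertices of $L(w)$. Then $H$ has an independent transversal with respect to $L$. (ii) Moreover, the conclusion may fail if the part size condition $2D^2$ is replaced by $D^2$: for every integer $D\ge 1$ there exist bipartite graphs $G$ and $H$ with bipartitions $(A_G,B_G)$ and $(A_H,B_H)$, respectively, such that $H$ is a bipartite cover of $G$ with respect to some $L: A_G\to 2^{A_H},\ B_G\to 2^{B_H}$, the maximum degree of $H$ is $D$, $|L(v)| \ge D^2$ for all $v\in A_G$, $|L(w)|=2$ for all $w\in B_G$, no vertex of $A_H$ is adjacent to both vertices of $L(w)$ for any $w\in B_G$, and $H$ has no independent transversal with respect to $L$.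
   Context: Graphs are simple and undirected. Let $G$ and $H$ be bipartite graphs with bipartitions $(A_G,B_G)$ and $(A_H,B_H)$. $H$ is a bipartite cover of $G$ with respect to a mapping $L:V(G)\to 2^{V(H)}$ if: (a) $L$ induces a partition of $V(H)$, i.e. the sets $L(v)$, $v\in V(G)$, are nonempty, pairwise disjoint and have union $V(H)$, and there are no edges of $H$ between $L(v)$ and $L(v')$ whenever $vv'\notin E(G)$; and (b) the sets $L(v)$, $v\in A_G$, partition $A_H$ and the sets $L(w)$, $w\in B_G$, partition $B_H$ (this is what is meant by writing $L: A_G\to 2^{A_H}, B_G\to 2^{B_H}$). No matching condition is imposed on the edges of $H$ between $L(v)$ and $L(v')$. An independent transversal of $H$ with respect to $L$ is an independent set of $H$ that contains exactly one vertex of each $L(v)$, $v\in V(G)$. *)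

theory Defs
  imports Main "HOL-Library.Disjoint_Sets"
begin

text \<open>Graphs are not assumed to be finite: finiteness is always stated separately.\<close>

record 'a ugraph =
  verts :: "'a set"
  edges :: "'a set set"

definition simple_graph :: "'a ugraph \<Rightarrow> bool" where
  "simple_graph G \<longleftrightarrow> (\<forall>e\<in>edges G. e \<subseteq> verts G \<and> card e = 2)"

definition bipartite :: "'a ugraph \<Rightarrow> 'a set \<Rightarrow> 'a set \<Rightarrow> bool" where
  "bipartite G A B \<longleftrightarrow>
     simple_graph G \<and> A \<union> B = verts G \<and> A \<inter> B = {} \<and>
     (\<forall>e\<in>edges G. \<exists>a\<in>A. \<exists>b\<in>B. e = {a, b})"

definition neighbours :: "'a ugraph \<Rightarrow> 'a \<Rightarrow> 'a set" where
  "neighbours G v = {u. {v, u} \<in> edges G}"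

text \<open>The graph without vertices has maximum degree 0. Finiteness of the neighbourhoods is
  required because \<^const>\<open>card\<close> is 0 on infinite sets.\<close>

definition has_max_degree :: "'a ugraph \<Rightarrow> nat \<Rightarrow> bool" where
  "has_max_degree G D \<longleftrightarrow>
     (\<forall>v\<in>verts G. finite (neighbours G v) \<and> card (neighbours G v) \<le> D) \<and>
     ((\<exists>v\<in>verts G. card (neighbours G v) = D) \<or> verts G = {} \<and> D = 0)"

text \<open>Partitions are indexed: distinct indices have disjoint parts, so that
  \<^const>\<open>partition_on\<close> for the image of \<open>L\<close> would be too weak.\<close>

definition partitions :: "('a \<Rightarrow> 'b set) \<Rightarrow> 'a set \<Rightarrow> 'b set \<Rightarrow> bool" where
  "partitions L I S \<longleftrightarrow>
     (\<forall>v\<in>I. L v \<noteq> {}) \<and> disjoint_family_on L I \<and> (\<Union>v\<in>I. L v) = S"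

definition cover :: "'a ugraph \<Rightarrow> 'b ugraph \<Rightarrow> ('a \<Rightarrow> 'b set) \<Rightarrow> bool" where
  "cover G H L \<longleftrightarrow>
     partitions L (verts G) (verts H) \<and>
     (\<forall>v\<in>verts G. \<forall>v'\<in>verts G. {v, v'} \<notin> edges G \<longrightarrow>
        (\<forall>x\<in>L v. \<forall>y\<in>L v'. {x, y} \<notin> edges H))"

definition bipartite_cover ::
  "'a ugraph \<Rightarrow> 'a set \<Rightarrow> 'a set \<Rightarrow> 'b ugraph \<Rightarrow> 'b set \<Rightarrow> 'b set \<Rightarrow> ('a \<Rightarrow> 'b set) \<Rightarrow> bool" where
  "bipartite_cover G A\<^sub>G B\<^sub>G H A\<^sub>H B\<^sub>H L \<longleftrightarrow>
     bipartite G A\<^sub>G B\<^sub>G \<and> bipartite H A\<^sub>H B\<^sub>H \<and> cover G H L \<and>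
     partitions L A\<^sub>G A\<^sub>H \<and> partitions L B\<^sub>G B\<^sub>H"

definition independent_set :: "'a ugraph \<Rightarrow> 'a set \<Rightarrow> bool" where
  "independent_set G T \<longleftrightarrow> T \<subseteq> verts G \<and> (\<forall>x\<in>T. \<forall>y\<in>T. {x, y} \<notin> edges G)"

definition independent_transversal ::
  "'a ugraph \<Rightarrow> 'b ugraph \<Rightarrow> ('a \<Rightarrow> 'b set) \<Rightarrow> 'b set \<Rightarrow> bool" where
  "independent_transversal G H L T \<longleftrightarrow>
     independent_set H T \<and> (\<forall>v\<in>verts G. \<exists>!x. x \<in> T \<inter> L v)"

end

theory Submission
  imports Defs "HOL-Library.Countable" "HOL-Analysis.Function_Topology"
begin

text \<open>For the positive part, call two vertices \<open>a\<close> and \<open>a'\<close> of \<open>A\<^sub>H\<close> conflicting if some \<open>L w = {b, b'}\<close>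
  with \<open>w \<in> B\<^sub>G\<close> has \<open>b\<close> adjacent to \<open>a\<close> and \<open>b'\<close> adjacent to \<open>a'\<close>. A conflict-free choice of one
  vertex in each large part leaves a free vertex in each \<open>L w\<close>, because no single vertex blocks both
  \<open>b\<close> and \<open>b'\<close>. The conflict graph has maximum degree at most \<open>D\<^sup>2\<close>, so what is needed is
  Haxell's theorem: nonempty parts of size at least \<open>2 * \<Delta>\<close> in a graph of maximum degree at most
  \<open>\<Delta>\<close> have an independent transversal (\<open>haxell_independent_transversal\<close>).

  For finitely many parts, Haxell's theorem comes from a domination statement
  (\<open>critical_edge_dominating_set\<close>): if no independent transversal exists, but deleting a single edge
  would create one, then some nonempty collection of \<open>m\<close> parts is dominated by at most \<open>2 * m - 2\<close>
  vertices. These have too few neighbours for \<open>m\<close> parts of size \<open>2 * \<Delta>\<close>. Since the graphs may be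
  infinite, a compactness argument (\<open>independent_choice_compactness\<close>) passes from finitely many parts
  to arbitrarily many.

  For the negative part, take two large parts, each split into \<open>D\<close> groups of \<open>D\<close> vertices, and for
  every pair of groups, one from each large part, a small part with one vertex joined
  to all of the one group and one vertex joined to all of the other. All degrees are \<open>D\<close>, and any
  two vertices, one from each large part, block the small part of their groups: the
  conflict graph is complete bipartite between the large parts.\<close>

section \<open>Haxell's theorem for finitely many parts\<close>

text \<open>A transversal is handled as a choice function on the index set. Pairs inside one part are
  never both chosen, so edges inside a part are irrelevant; this is why only distinct indices are
  compared, and it lets two parts be merged below without touching the edge set.\<close>

definition independent_choice :: "'b set set \<Rightarrow> 'i set \<Rightarrow> ('i \<Rightarrow> 'b set) \<Rightarrow> ('i \<Rightarrow> 'b) \<Rightarrow> bool" where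
  "independent_choice E I V t \<longleftrightarrow>
     (\<forall>i\<in>I. t i \<in> V i) \<and> (\<forall>i\<in>I. \<forall>j\<in>I. i \<noteq> j \<longrightarrow> {t i, t j} \<notin> E)"

text \<open>Restoring the deleted edges of \<open>F\<close> one at a time must destroy the last independent choice at
  some moment. Accordingly, \<open>F'\<close> is taken maximal among the subsets of \<open>F\<close> whose deletion does
  not create one.\<close>

lemma critical_edge:
  assumes "finite F"
    and "independent_choice (E - F) I V t"
    and "\<nexists>t. independent_choice E I V t"
  obtains F' e where "F' \<subseteq> F" "e \<in> F" "\<nexists>t. independent_choice (E - F') I V t"
    and "\<exists>t. independent_choice (E - F' - {e}) I V t"
proof -
  define \<F> where "\<F> = {F'. F' \<subseteq> F \<and> (\<nexists>t. independent_choice (E - F') I V t)}"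
  have "finite \<F>" "\<F> \<noteq> {}"
    using assms(1,3) by (auto simp: \<F>_def)
  from finite_has_maximal[OF this] obtain F' where F': "F' \<in> \<F>"
    and max: "\<forall>F''\<in>\<F>. F' \<subseteq> F'' \<longrightarrow> F' = F''"
    by (elim bexE)
  then have free: "F' \<subseteq> F" "\<nexists>t. independent_choice (E - F') I V t"
    by (simp_all add: \<F>_def)
  then have "F' \<noteq> F"
    using assms(2) by blast
  with free(1) obtain e where e: "e \<in> F" "e \<notin> F'"
    by blast
  then have "insert e F' \<notin> \<F>"
    using max by blast
  then have "\<exists>t. independent_choice (E - insert e F') I V t"
    using e(1) free(1) by (simp add: \<F>_def)
  moreover have "E - insert e F' = E - F' - {e}"
    by auto
  ultimately show ?thesis
    using that[OF free(1) e(1) free(2)] by simp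
qed

text \<open>The combinatorial core. Let \<open>t\<close> be independent apart from the critical edge \<open>e\<close>; then \<open>e\<close> joins
  \<open>x = t i\<close> to \<open>y = t j\<close>. Delete all neighbours of \<open>x\<close> and of \<open>y\<close> and merge what remains of the
  parts \<open>i\<close> and \<open>j\<close> into one part. An independent choice for this smaller system picks a vertex in
  only one of the parts \<open>i\<close> and \<open>j\<close>, and \<open>x\<close> or \<open>y\<close> can be added for the other one; so the
  smaller system has none either. If the merged part is empty, \<open>{x, y}\<close> dominates both parts.
  Otherwise take \<open>z\<close> in it and replace \<open>x\<close> and \<open>y\<close> by \<open>z\<close> in \<open>t\<close>: the only obstructing edges
  contain \<open>z\<close>, so a critical edge through \<open>z\<close> can be found and the induction hypothesis applies.

  That \<open>S\<close> covers the critical edge is what drives the induction: it forces the merged part to be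
  among the dominated parts. Undoing the merge then adds one part and, with \<open>x\<close> and \<open>y\<close>, two
  dominating vertices, which preserves the inequality between the cardinalities.\<close>

lemma critical_edge_dominating_set:
  assumes "finite I" "disjoint_family_on V I"
    and "\<nexists>t. independent_choice E I V t"
    and "\<exists>t. independent_choice (E - {e}) I V t"
  shows "\<exists>S X. S \<subseteq> I \<and> finite X \<and> card X + 2 \<le> 2 * card S \<and> e \<subseteq> (\<Union>i\<in>S. V i) \<and>
           (\<forall>u \<in> (\<Union>i\<in>S. V i). \<exists>x\<in>X. {x, u} \<in> E)"
  using assms
proof (induction "card I" arbitrary: I V E e rule: less_induct)
  case less
  obtain t where t: "independent_choice (E - {e}) I V t"
    using less.prems by blast
  have "\<not> independent_choice E I V t"
    using less.prems by blast
  with t obtain i j where ij: "i \<in> I" "j \<in> I" "i \<noteq> j" and e: "e = {t i, t j}" "e \<in> E"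
    unfolding independent_choice_def by blast
  define x y where "x = t i" and "y = t j"
  have tV: "t k \<in> V k" if "k \<in> I" for k
    using t that unfolding independent_choice_def by blast
  have e': "e = {x, y}" and xy: "x \<in> V i" "y \<in> V j"
    using e tV ij by (auto simp: x_def y_def)
  have part_unique: "k = l" if "u \<in> V k" "u \<in> V l" "k \<in> I" "l \<in> I" for u k l
    using less.prems(2) that unfolding disjoint_family_on_def by blast
  define N where "N = {u. {x, u} \<in> E \<or> {y, u} \<in> E}"
  define I' where "I' = I - {j}"
  define V' where "V' = (\<lambda>k. (if k = i then V i \<union> V j else V k) - N)"
  show ?case
  proof (cases "V' i = {}")
    case True
    show ?thesis
    proof (intro exI[of _ "{i, j}"] exI[of _ "{x, y}"] conjI)
      show "card {x, y} + 2 \<le> 2 * card {i, j}"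
        using \<open>i \<noteq> j\<close> by (simp add: card_insert_if)
      show "\<forall>u \<in> (\<Union>k\<in>{i, j}. V k). \<exists>v\<in>{x, y}. {v, u} \<in> E"
        using True by (auto simp: V'_def N_def)
    qed (use ij e' xy in auto)
  next
    case False
    then obtain z where z: "z \<in> V' i"
      by blast
    \<comment> \<open>The merged part keeps the index \<open>i\<close>, and \<open>j\<close> is dropped.\<close>
    have disj': "disjoint_family_on V' I'"
      unfolding disjoint_family_on_def V'_def I'_def using part_unique ij
      by (auto split: if_splits)
    have free': "\<nexists>t. independent_choice E I' V' t"
    proof
      assume "\<exists>t. independent_choice E I' V' t"
      then obtain s where s: "independent_choice E I' V' s" ..
      have sV': "s k \<in> V' k" if "k \<in> I" "k \<noteq> j" for k
        using s that unfolding independent_choice_def I'_def by blast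
      have indep: "{s k, s l} \<notin> E" if "k \<in> I" "l \<in> I" "k \<noteq> j" "l \<noteq> j" "k \<noteq> l" for k l
        using s that unfolding independent_choice_def I'_def by blast
      have notN: "{x, s k} \<notin> E" "{y, s k} \<notin> E" "{s k, x} \<notin> E" "{s k, y} \<notin> E"
        if "k \<in> I" "k \<noteq> j" for k
        using sV'[OF that] by (auto simp: V'_def N_def insert_commute)
      have other: "s k \<in> V k" if "k \<in> I" "k \<noteq> j" "k \<noteq> i" for k
        using sV'[OF that(1,2)] that(3) by (simp add: V'_def)
      \<comment> \<open>The part that \<open>s\<close> misses receives its own end of \<open>e\<close>, whose neighbours were deleted.\<close>
      have "s i \<in> V i \<or> s i \<in> V j"
        using sV'[OF ij(1,3)] by (simp add: V'_def)
      then show False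
      proof
        assume "s i \<in> V i"
        then have "independent_choice E I V (s(j := y))"
          unfolding independent_choice_def using other xy notN indep by auto
        with less.prems(3) show False by blast
      next
        assume "s i \<in> V j"
        then have "independent_choice E I V (s(i := x, j := s i))"
          unfolding independent_choice_def using other xy notN indep ij by auto
        with less.prems(3) show False by blast
      qed
    qed
    define F where "F = (\<lambda>k. {z, t k}) ` (I' - {i})"
    have "finite F"
      using less.prems(1) by (simp add: F_def I'_def)
    have t_indep: "{t k, t l} \<notin> E" if "k \<in> I'" "l \<in> I" "k \<noteq> i" "k \<noteq> l" for k l
    proof -
      have "t k \<noteq> x" "t k \<noteq> y"
        using part_unique[of _ k i] part_unique[of _ k j] tV[of k] xy that ij
        by (auto simp: I'_def)
      then have "{t k, t l} \<noteq> e"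
        using e' by auto
      then show ?thesis
        using t that unfolding independent_choice_def I'_def by blast
    qed
    have t_notN: "t k \<notin> N" if "k \<in> I'" "k \<noteq> i" for k
      using t_indep[OF that(1) ij(1) that(2)] t_indep[OF that(1) ij(2) that(2)] that
      by (auto simp: N_def x_def y_def insert_commute I'_def)
    have "independent_choice (E - F) I' V' (t(i := z))"
      unfolding independent_choice_def
    proof (intro conjI ballI impI)
      fix k assume "k \<in> I'"
      then show "(t(i := z)) k \<in> V' k"
        using z t_notN tV by (auto simp: V'_def I'_def)
    next
      fix k l assume "k \<in> I'" "l \<in> I'" "k \<noteq> l"
      then show "{(t(i := z)) k, (t(i := z)) l} \<notin> E - F"
        using t_indep[of k l] by (auto simp: F_def I'_def insert_commute)
    qed
    then obtain F' f where F': "F' \<subseteq> F" and f: "f \<in> F"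
      and crit: "\<nexists>t. independent_choice (E - F') I' V' t"
        "\<exists>t. independent_choice (E - F' - {f}) I' V' t"
      using critical_edge[OF \<open>finite F\<close> _ free'] by metis
    have "card I' < card I"
      unfolding I'_def using less.prems(1) ij(2) by (rule card_Diff1_less)
    moreover have "finite I'"
      using less.prems(1) by (simp add: I'_def)
    note less.hyps[OF calculation this disj' crit]
    then obtain S X where S: "S \<subseteq> I'" "finite X" "card X + 2 \<le> 2 * card S"
      and fS: "f \<subseteq> (\<Union>k\<in>S. V' k)"
      and dom: "\<forall>u \<in> (\<Union>k\<in>S. V' k). \<exists>v\<in>X. {v, u} \<in> E - F'"
      by (elim exE conjE)
    \<comment> \<open>Every candidate for the new critical edge contains \<open>z\<close>, so the merged part lies in \<open>S\<close>.\<close>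
    have "z \<in> f"
      using f by (auto simp: F_def)
    then obtain k where k: "k \<in> S" "z \<in> V' k"
      using fS by blast
    moreover have "i \<in> I'" "k \<in> I'"
      using ij k(1) S(1) by (auto simp: I'_def)
    ultimately have iS: "i \<in> S"
      using z disjoint_family_onD[OF disj', of i k] by (cases "k = i") auto
    show ?thesis
    proof (intro exI[of _ "insert j S"] exI[of _ "X \<union> {x, y}"] conjI)
      show "insert j S \<subseteq> I"
        using S ij by (auto simp: I'_def)
      have "finite S" "j \<notin> S"
        using S(1) \<open>finite I'\<close> by (auto simp: I'_def intro: finite_subset)
      moreover have "card (X \<union> {x, y}) \<le> card X + card {x, y}"
        by (rule card_Un_le)
      moreover have "card {x, y} \<le> 2"
        by (simp add: card_insert_if)
      ultimately show "card (X \<union> {x, y}) + 2 \<le> 2 * card (insert j S)"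
        using S(3) by simp
      show "e \<subseteq> (\<Union>k\<in>insert j S. V k)"
        using e' xy iS by auto
      show "\<forall>u \<in> (\<Union>k\<in>insert j S. V k). \<exists>v\<in>X \<union> {x, y}. {v, u} \<in> E"
      proof
        fix u assume "u \<in> (\<Union>k\<in>insert j S. V k)"
        then have "u \<in> N \<or> u \<in> (\<Union>k\<in>S. V' k)"
          using iS by (auto simp: V'_def)
        then show "\<exists>v\<in>X \<union> {x, y}. {v, u} \<in> E"
          using dom by (auto simp: N_def)
      qed
    qed (use S in auto)
  qed
qed

text \<open>If there were no independent choice, enough edges could be deleted to reach a critical edge,
  since an arbitrary choice function is obstructed by finitely many edges only. The
  at most \<open>2 * card S - 2\<close> dominating vertices have at most \<open>(2 * card S - 2) * \<Delta>\<close> neighbours, too few to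
  dominate \<open>card S\<close> disjoint parts of size \<open>2 * \<Delta>\<close>. A set that dominates after
  edges were deleted also dominates in the original graph, whose degrees may thus be used.\<close>

lemma haxell_finite:
  assumes "finite I" "disjoint_family_on V I"
    and "\<And>i. i \<in> I \<Longrightarrow> finite (V i) \<and> V i \<noteq> {} \<and> 2 * \<Delta> \<le> card (V i)"
    and deg: "\<And>x. finite {u. {x, u} \<in> E} \<and> card {u. {x, u} \<in> E} \<le> \<Delta>"
  shows "\<exists>t. independent_choice E I V t"
proof (rule ccontr)
  assume free: "\<not> ?thesis"
  define t where "t i = (SOME x. x \<in> V i)" for i
  define F where "F = (\<lambda>(i, j). {t i, t j}) ` (I \<times> I)"
  have "t i \<in> V i" if "i \<in> I" for i
    using assms(3)[OF that] some_in_eq[of "V i"] by (simp add: t_def)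
  then have "independent_choice (E - F) I V t"
    unfolding independent_choice_def F_def by auto
  moreover have "finite F"
    using assms(1) by (simp add: F_def)
  ultimately obtain F' e where crit: "\<nexists>t. independent_choice (E - F') I V t"
      "\<exists>t. independent_choice (E - F' - {e}) I V t"
    using critical_edge free by metis
  from critical_edge_dominating_set[OF assms(1,2) crit]
  obtain S X where S: "S \<subseteq> I" "finite X" "card X + 2 \<le> 2 * card S"
    and dom: "\<forall>u \<in> (\<Union>i\<in>S. V i). \<exists>x\<in>X. {x, u} \<in> E - F'"
    by (elim exE conjE)
  have "finite S"
    using S(1) assms(1) by (rule finite_subset)
  have dom_sub: "(\<Union>i\<in>S. V i) \<subseteq> (\<Union>x\<in>X. {u. {x, u} \<in> E})"
    using dom by fastforce
  \<comment> \<open>Strictness of the count needs \<open>\<Delta> > 0\<close>: some vertex of a nonempty part is dominated.\<close>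
  have "S \<noteq> {}"
    using S(3) by auto
  then obtain i where "i \<in> S" by blast
  have "V i \<noteq> {}"
    using \<open>i \<in> S\<close> S(1) assms(3) by blast
  then obtain u x where "{x, u} \<in> E"
    using dom \<open>i \<in> S\<close> by blast
  then have "{u. {x, u} \<in> E} \<noteq> {}"
    by blast
  then have "\<Delta> > 0"
    using deg[of x] card_gt_0_iff by fastforce
  have "2 * card S * \<Delta> = (\<Sum>i\<in>S. 2 * \<Delta>)"
    by simp
  also have "\<dots> \<le> (\<Sum>i\<in>S. card (V i))"
    using assms(3) S(1) by (intro sum_mono) blast
  also have "\<dots> = card (\<Union>i\<in>S. V i)"
    using \<open>finite S\<close> S(1) assms(2,3)
    by (intro card_UN_disjoint[symmetric]) (auto simp: disjoint_family_on_def subset_iff)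
  also have "\<dots> \<le> card (\<Union>x\<in>X. {u. {x, u} \<in> E})"
    using dom_sub S(2) deg by (intro card_mono) auto
  also have "\<dots> \<le> (\<Sum>x\<in>X. card {u. {x, u} \<in> E})"
    using S(2) by (rule card_UN_le)
  also have "\<dots> \<le> card X * \<Delta>"
    using sum_bounded_above[of X "\<lambda>x. card {u. {x, u} \<in> E}" \<Delta>] deg by simp
  also have "\<dots> < 2 * card S * \<Delta>"
    using S(3) \<open>\<Delta> > 0\<close> by (intro mult_strict_right_mono) auto
  finally show False
    by simp
qed

section \<open>Infinitely many parts\<close>

text \<open>The choice functions form a compact space by Tychonoff's theorem, the parts being finite and
  discrete. Avoiding one conflict is a closed condition, as it concerns two coordinates only, and
  finitely many such conditions involve only finitely many parts.\<close>

lemma independent_choice_compactness: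
  assumes fin: "\<And>i. i \<in> I \<Longrightarrow> finite (V i)"
    and ex: "\<And>J. finite J \<Longrightarrow> J \<subseteq> I \<Longrightarrow> \<exists>t. independent_choice E J V t"
  shows "\<exists>t. independent_choice E I V t"
proof -
  define X where "X = product_topology (\<lambda>i. discrete_topology (V i)) I"
  define C where "C = (\<lambda>(i, j). {t \<in> topspace X. {t i, t j} \<notin> E})"
  define K where "K = {(i, j). i \<in> I \<and> j \<in> I \<and> i \<noteq> j}"
  have top: "topspace X = PiE I V"
    by (simp add: X_def)
  have ne: "V i \<noteq> {}" if "i \<in> I" for i
    using ex[of "{i}"] that by (auto simp: independent_choice_def)
  have some_in: "(SOME p. p \<in> V i) \<in> V i" if "i \<in> I" for i
    using ne[OF that] by (simp add: some_in_eq)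
  have "compact_space X"
    unfolding X_def compact_space_product_topology
    using fin by (simp add: compact_space_discrete_topology)
  have closed: "closedin X (C (i, j))" if "i \<in> I" "j \<in> I" for i j
  proof -
    have pre: "closedin X {t \<in> topspace X. t k = p}" if "k \<in> I" "p \<in> V k" for k p
    proof -
      have "continuous_map X (discrete_topology (V k)) (\<lambda>t. t k)"
        unfolding X_def using that by (rule_tac continuous_map_product_projection)
      from closedin_continuous_map_preimage[OF this, of "{p}"] that show ?thesis
        by simp
    qed
    have "C (i, j) = (\<Union>(p, q) \<in> {(p, q) \<in> V i \<times> V j. {p, q} \<notin> E}.
                        {t \<in> topspace X. t i = p} \<inter> {t \<in> topspace X. t j = q})"
      using that by (auto simp: C_def top)
    moreover have "finite {(p, q) \<in> V i \<times> V j. {p, q} \<notin> E}"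
      using fin that by (auto intro: finite_subset[of _ "V i \<times> V j"])
    ultimately show ?thesis
      using pre that by (auto intro!: closedin_Union)
  qed
  have "\<Inter> (insert (topspace X) (C ` K)) \<noteq> {}"
  proof -
    have "\<Inter>\<F> \<noteq> {}" if \<F>: "finite \<F>" "\<F> \<subseteq> insert (topspace X) (C ` K)" for \<F>
    proof -
      have "finite (\<F> - {topspace X})" "\<F> - {topspace X} \<subseteq> C ` K"
        using \<F> by auto
      then obtain K' where K': "K' \<subseteq> K" "finite K'" "\<F> - {topspace X} = C ` K'"
        using finite_subset_image by metis
      define J where "J = fst ` K' \<union> snd ` K'"
      have J: "finite J" "J \<subseteq> I"
        using K' by (auto simp: J_def K_def)
      then obtain s where s: "independent_choice E J V s"
        using ex by blast
      define t where "t = (\<lambda>i\<in>I. if i \<in> J then s i else SOME p. p \<in> V i)"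
      have t_top: "t \<in> topspace X"
        using s ne unfolding top t_def independent_choice_def by (auto intro: some_in)
      have "t \<in> C c" if "c \<in> K'" for c
      proof -
        obtain i j where "c = (i, j)" by (cases c)
        then have "i \<in> J" "j \<in> J" "i \<noteq> j"
          using that K'(1) by (force simp: J_def K_def)+
        with \<open>c = (i, j)\<close> show ?thesis
          using s t_top J(2) by (auto simp: C_def t_def independent_choice_def)
      qed
      then have "t \<in> \<Inter> (insert (topspace X) (C ` K'))"
        using t_top by blast
      moreover have "\<F> \<subseteq> insert (topspace X) (C ` K')"
        using K'(3) by blast
      ultimately show ?thesis
        by blast
    qed
    moreover have "\<forall>S \<in> insert (topspace X) (C ` K). closedin X S"
      using closed by (auto simp: K_def)
    ultimately show ?thesis
      using \<open>compact_space X\<close>[unfolded compact_space_fip, THEN spec,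
          of "insert (topspace X) (C ` K)"] by simp
  qed
  then obtain t where t: "t \<in> topspace X" "\<forall>c\<in>K. t \<in> C c"
    by blast
  have "t i \<in> V i" if "i \<in> I" for i
    using t(1) that by (auto simp: top)
  moreover have "{t i, t j} \<notin> E" if "i \<in> I" "j \<in> I" "i \<noteq> j" for i j
    using bspec[OF t(2), of "(i, j)"] that by (simp add: C_def K_def)
  ultimately have "independent_choice E I V t"
    unfolding independent_choice_def by blast
  then show ?thesis
    by blast
qed

text \<open>Infinite parts are first cut down to finite ones. The bound \<open>2 * \<Delta>\<close> alone would allow empty
  subsets when \<open>\<Delta> = 0\<close>, so one more vertex is kept.\<close>

theorem haxell_independent_transversal:
  assumes disj: "disjoint_family_on V I"
    and ne: "\<And>i. i \<in> I \<Longrightarrow> V i \<noteq> {}"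
    and size: "\<And>i. i \<in> I \<Longrightarrow> finite (V i) \<Longrightarrow> 2 * \<Delta> \<le> card (V i)"
    and deg: "\<And>x. finite {u. {x, u} \<in> E} \<and> card {u. {x, u} \<in> E} \<le> \<Delta>"
  shows "\<exists>t. independent_choice E I V t"
proof -
  have "\<forall>i\<in>I. \<exists>W. W \<subseteq> V i \<and> finite W \<and> W \<noteq> {} \<and> 2 * \<Delta> \<le> card W"
  proof
    fix i assume i: "i \<in> I"
    show "\<exists>W. W \<subseteq> V i \<and> finite W \<and> W \<noteq> {} \<and> 2 * \<Delta> \<le> card W"
    proof (cases "finite (V i)")
      case True
      then show ?thesis
        using ne[OF i] size[OF i] by (intro exI[of _ "V i"]) simp
    next
      case False
      then obtain W where "finite W" "card W = 2 * \<Delta> + 1" "W \<subseteq> V i"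
        using infinite_arbitrarily_large by metis
      then show ?thesis
        by (intro exI[of _ W]) auto
    qed
  qed
  from bchoice[OF this] obtain W where W:
      "\<forall>i\<in>I. W i \<subseteq> V i \<and> finite (W i) \<and> W i \<noteq> {} \<and> 2 * \<Delta> \<le> card (W i)" ..
  have "\<exists>t. independent_choice E J W t" if "finite J" "J \<subseteq> I" for J
  proof (rule haxell_finite[OF that(1) _ _ deg])
    show "disjoint_family_on W J"
      using disj W that(2) unfolding disjoint_family_on_def by blast
  qed (use W that(2) in blast)
  from independent_choice_compactness[OF _ this] W
  obtain t where "independent_choice E I W t"
    by blast
  then have "independent_choice E I V t"
    using W unfolding independent_choice_def by blast
  then show ?thesis
    by blast
qed

section \<open>Covers with small parts on one side\<close>

text \<open>A choice of vertices in \<open>A'\<close> extends to the part \<open>{b, p b}\<close> unless both \<open>b\<close> and its partner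
  \<open>p b\<close> have chosen neighbours. Joining \<open>a\<close> to \<open>a'\<close> when \<open>a\<close> is adjacent to some \<open>b\<close> and \<open>a'\<close> to
  \<open>p b\<close> turns this obstruction into an edge of an auxiliary graph on \<open>A'\<close>. A vertex \<open>a\<close> has at
  most \<open>D\<close> choices for \<open>b\<close>, then \<open>p b\<close> is determined, and \<open>D\<close> choices remain for \<open>a'\<close>, so the
  auxiliary graph has maximum degree at most \<open>D\<^sup>2\<close> and Haxell's theorem applies. As no vertex
  is adjacent to both \<open>b\<close> and \<open>p b\<close>, the two chosen neighbours in an obstruction always come from
  distinct parts, where independence in the auxiliary graph excludes them.\<close>

lemma bipartite_cover_independent_transversal:
  assumes cov: "bipartite_cover G A B H A' B' L"
    and deg: "has_max_degree H D"
    and size: "\<And>v. v \<in> A \<Longrightarrow> finite (L v) \<Longrightarrow> 2 * D ^ 2 \<le> card (L v)"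
    and two: "\<And>w. w \<in> B \<Longrightarrow> card (L w) = 2"
    and no_common: "\<not> (\<exists>w\<in>B. \<exists>a\<in>A'. \<forall>b\<in>L w. {a, b} \<in> edges H)"
  shows "\<exists>T. independent_transversal G H L T"
proof -
  have G: "verts G = A \<union> B" and H: "verts H = A' \<union> B'" "A' \<inter> B' = {}"
    and edge: "\<forall>e\<in>edges H. \<exists>a\<in>A'. \<exists>b\<in>B'. e = {a, b}"
    using cov unfolding bipartite_cover_def bipartite_def by (elim conjE, simp)+
  have LA: "v \<in> A \<Longrightarrow> L v \<noteq> {} \<and> L v \<subseteq> A'" for v
    using cov unfolding bipartite_cover_def partitions_def by blast
  have LB: "(\<Union>w\<in>B. L w) = B'"
    using cov unfolding bipartite_cover_def partitions_def by blast
  have disj: "disjoint_family_on L (verts G)"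
    using cov unfolding bipartite_cover_def cover_def partitions_def by blast
  have part_unique: "v = v'" if "x \<in> L v" "x \<in> L v'" "v \<in> verts G" "v' \<in> verts G" for x v v'
    using disjoint_family_onD[OF disj, of v v'] that by blast
  have across: "x \<in> A' \<and> y \<in> B' \<or> x \<in> B' \<and> y \<in> A'" if xy: "{x, y} \<in> edges H" for x y
  proof -
    obtain a b where "a \<in> A'" "b \<in> B'" "{x, y} = {a, b}"
      using edge xy by blast
    then show ?thesis
      by (auto simp: doubleton_eq_iff)
  qed
  have nbrs: "finite (neighbours H x) \<and> card (neighbours H x) \<le> D" for x
  proof (cases "x \<in> verts H")
    case True
    with deg show ?thesis
      unfolding has_max_degree_def by blast
  next
    case False
    then have "neighbours H x = {}"
      using across H(1) unfolding neighbours_def by blast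
    then show ?thesis by simp
  qed
  have "\<forall>b\<in>B'. \<exists>b'. b' \<noteq> b \<and> (\<forall>w\<in>B. b \<in> L w \<longrightarrow> L w = {b, b'})"
  proof
    fix b assume "b \<in> B'"
    then obtain w where w: "w \<in> B" "b \<in> L w"
      using LB by blast
    then obtain b' where "L w = {b, b'}" "b' \<noteq> b"
      using two[OF w(1)] by (auto simp: card_2_iff doubleton_eq_iff)
    moreover have "w' = w" if "w' \<in> B" "b \<in> L w'" for w'
      using part_unique[OF that(2) w(2)] that(1) w(1) G by blast
    ultimately show "\<exists>b'. b' \<noteq> b \<and> (\<forall>w\<in>B. b \<in> L w \<longrightarrow> L w = {b, b'})"
      by blast
  qed
  from bchoice[OF this] obtain p where
    p: "\<forall>b\<in>B'. p b \<noteq> b \<and> (\<forall>w\<in>B. b \<in> L w \<longrightarrow> L w = {b, p b})" ..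
  have p_p: "p (p b) = b" if b: "b \<in> B'" for b
  proof -
    obtain w where w: "w \<in> B" "b \<in> L w"
      using LB b by blast
    then have Lw: "L w = {b, p b}" "p b \<noteq> b"
      using p b by blast+
    then have "p b \<in> B'"
      using LB w(1) by blast
    then have "L w = {p b, p (p b)}"
      using p w(1) Lw(1) by blast
    with Lw show "p (p b) = b"
      by (metis doubleton_eq_iff)
  qed
  \<comment> \<open>The partner map is an involution, so reading an edge \<open>{a, a'}\<close> backwards gives the same bound.\<close>
  define E where "E = {{a, a'} | a a' b. b \<in> B' \<and> {a, b} \<in> edges H \<and> {a', p b} \<in> edges H}"
  have degE: "finite {u. {x, u} \<in> E} \<and> card {u. {x, u} \<in> E} \<le> D ^ 2" for x
  proof -
    let ?U = "\<Union>b\<in>neighbours H x. neighbours H (p b)"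
    have sub: "{u. {x, u} \<in> E} \<subseteq> ?U"
    proof
      fix u assume "u \<in> {u. {x, u} \<in> E}"
      then obtain a a' b where b: "b \<in> B'" "{a, b} \<in> edges H" "{a', p b} \<in> edges H"
        and "{x, u} = {a, a'}"
        unfolding E_def by blast
      then have "x = a \<and> u = a' \<or> x = a' \<and> u = a"
        by (auto simp: doubleton_eq_iff)
      then show "u \<in> ?U"
      proof
        assume "x = a \<and> u = a'"
        then have "b \<in> neighbours H x" "u \<in> neighbours H (p b)"
          using b by (simp_all add: neighbours_def insert_commute)
        then show ?thesis by blast
      next
        assume "x = a' \<and> u = a"
        then have "p b \<in> neighbours H x" "u \<in> neighbours H (p (p b))"
          using b by (simp_all add: neighbours_def insert_commute p_p)
        then show ?thesis by blast
      qed
    qed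
    have fin: "finite ?U"
      using nbrs by blast
    have "card ?U \<le> (\<Sum>b\<in>neighbours H x. card (neighbours H (p b)))"
      using nbrs by (intro card_UN_le) blast
    also have "\<dots> \<le> card (neighbours H x) * D"
      using sum_bounded_above[of "neighbours H x" "\<lambda>b. card (neighbours H (p b))" D] nbrs
      by simp
    also have "\<dots> \<le> D ^ 2"
      using nbrs[of x] by (simp add: power2_eq_square)
    finally have "card ?U \<le> D ^ 2" .
    with sub fin show ?thesis
      using card_mono[OF fin sub] finite_subset[OF sub fin] by simp
  qed
  have "disjoint_family_on L A"
    using disj G unfolding disjoint_family_on_def by blast
  from haxell_independent_transversal[OF this _ size degE] LA obtain t where t: "independent_choice E A L t"
    by blast
  have "\<forall>w\<in>B. \<exists>b. b \<in> L w \<and> (\<forall>v\<in>A. {t v, b} \<notin> edges H)"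
  proof (intro ballI, rule ccontr)
    fix w assume w: "w \<in> B" "\<not> (\<exists>b. b \<in> L w \<and> (\<forall>v\<in>A. {t v, b} \<notin> edges H))"
    have "L w \<noteq> {}"
      using two[OF w(1)] by auto
    then obtain b where b: "b \<in> L w" "b \<in> B'"
      using LB w(1) by blast
    then have Lw: "L w = {b, p b}"
      using p w(1) by blast
    obtain v where v: "v \<in> A" "{t v, b} \<in> edges H"
      using w(2) Lw by blast
    obtain v' where v': "v' \<in> A" "{t v', p b} \<in> edges H"
      using w(2) Lw by blast
    have "t v \<in> A'"
      using across[OF v(2)] b(2) H(2) by blast
    then have "v \<noteq> v'"
      using no_common w(1) Lw v(2) v'(2) by auto
    moreover have "{t v, t v'} \<in> E"
      unfolding E_def using b(2) v(2) v'(2) by blast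
    ultimately show False
      using t v(1) v'(1) unfolding independent_choice_def by blast
  qed
  from bchoice[OF this] obtain c where
    c: "\<forall>w\<in>B. c w \<in> L w \<and> (\<forall>v\<in>A. {t v, c w} \<notin> edges H)" ..
  define s where "s v = (if v \<in> A then t v else c v)" for v
  have sL: "s v \<in> L v" if "v \<in> verts G" for v
    using that t c G unfolding s_def independent_choice_def by auto
  have no_edge: "{s v, s w} \<notin> edges H"
    if "v \<in> verts G" "w \<in> verts G" "s v \<in> A'" "s w \<in> B'" for v w
  proof -
    have "v \<in> A"
      using that(1,3) sL[of v] LB G H(2) by blast
    moreover have "w \<notin> A"
      using that(2,4) sL[of w] LA H(2) by blast
    ultimately show ?thesis
      using c that(2) G by (auto simp: s_def)
  qed
  have "independent_transversal G H L (s ` verts G)"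
    unfolding independent_transversal_def independent_set_def
  proof (intro conjI ballI)
    show "s ` verts G \<subseteq> verts H"
      using sL LA LB G H(1) by blast
    show "{x, y} \<notin> edges H" if "x \<in> s ` verts G" "y \<in> s ` verts G" for x y
    proof
      assume e: "{x, y} \<in> edges H"
      then have "{y, x} \<in> edges H"
        by (simp add: insert_commute)
      with e across[OF e] no_edge that show False
        by blast
    qed
    show "\<exists>!x. x \<in> s ` verts G \<inter> L v" if "v \<in> verts G" for v
    proof (rule ex1I)
      show "s v \<in> s ` verts G \<inter> L v"
        using that sL by blast
      show "x = s v" if "x \<in> s ` verts G \<inter> L v" for x
        using that part_unique[OF _ _ _ \<open>v \<in> verts G\<close>] sL by blast
    qed
  qed
  then show ?thesis ..
qed

section \<open>A cover with large parts of order \<open>D\<^sup>2\<close> and no independent transversal\<close>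

text \<open>The Boolean \<open>s\<close> names one of two large parts. Each of them is a \<open>D\<close> by \<open>D\<close> grid, split into
  \<open>D\<close> groups: \<open>hub_vertex s i k\<close> is the vertex number \<open>k\<close> of group \<open>i\<close>.\<close>

definition hub_vertex :: "bool \<Rightarrow> nat \<Rightarrow> nat \<Rightarrow> nat" where
  "hub_vertex s i k = to_nat (True, s, i, k)"

text \<open>For each pair of a group \<open>i\<close> of the part \<open>False\<close> and a group \<open>j\<close> of the part \<open>True\<close> there are two
  vertices, one for each side \<open>s\<close>.\<close>

definition link_vertex :: "bool \<Rightarrow> nat \<Rightarrow> nat \<Rightarrow> nat" where
  "link_vertex s i j = to_nat (False, s, i, j)"

definition hubs :: "nat \<Rightarrow> bool \<Rightarrow> nat set" where
  "hubs D s = {hub_vertex s i k | i k. i < D \<and> k < D}"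

definition links :: "nat \<Rightarrow> nat \<Rightarrow> nat set" where
  "links i j = {link_vertex s i j | s. True}"

text \<open>The group on side \<open>s\<close> to which the vertex \<open>link_vertex s i j\<close> is attached.\<close>

definition hub_group :: "bool \<Rightarrow> nat \<Rightarrow> nat \<Rightarrow> nat" where
  "hub_group s i j = (if s then j else i)"

text \<open>The base graph is the complete bipartite graph between two hubs and \<open>D\<^sup>2\<close> links. The same
  injective codes are reused as names of its vertices, with \<open>0\<close> and \<open>False\<close> as fillers in
  the unused coordinates.\<close>

definition grid_base :: "nat \<Rightarrow> nat ugraph" where
  "grid_base D = \<lparr>
     verts = range (\<lambda>s. hub_vertex s 0 0) \<union> {link_vertex False i j | i j. i < D \<and> j < D},
     edges = {{hub_vertex s 0 0, link_vertex False i j} | s i j. i < D \<and> j < D}\<rparr>"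

definition grid_cover :: "nat \<Rightarrow> nat ugraph" where
  "grid_cover D = \<lparr>
     verts = (\<Union>s. hubs D s) \<union> {link_vertex s i j | s i j. i < D \<and> j < D},
     edges = {{hub_vertex s (hub_group s i j) k, link_vertex s i j} | s i j k.
                i < D \<and> j < D \<and> k < D}\<rparr>"

definition grid_part :: "nat \<Rightarrow> nat \<Rightarrow> nat set" where
  "grid_part D n = (case from_nat n :: bool \<times> bool \<times> nat \<times> nat of
     (is_hub, s, i, j) \<Rightarrow> if is_hub then hubs D s else links i j)"

lemma vertex_eq_iff [simp]:
  "hub_vertex s i k = hub_vertex s' i' k' \<longleftrightarrow> s = s' \<and> i = i' \<and> k = k'"
  "link_vertex s i k = link_vertex s' i' k' \<longleftrightarrow> s = s' \<and> i = i' \<and> k = k'"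
  "hub_vertex s i k \<noteq> link_vertex s' i' k'"
  "link_vertex s i k \<noteq> hub_vertex s' i' k'"
  by (auto simp: hub_vertex_def link_vertex_def)

lemma grid_part_simps [simp]:
  "grid_part D (hub_vertex s i k) = hubs D s"
  "grid_part D (link_vertex s i j) = links i j"
  by (auto simp: grid_part_def hub_vertex_def link_vertex_def)

lemma hub_group_less: "i < D \<Longrightarrow> j < D \<Longrightarrow> hub_group s i j < D"
  by (simp add: hub_group_def)

lemma grid_cover_edge_iff:
  "{hub_vertex s i' k, link_vertex s' i j} \<in> edges (grid_cover D) \<longleftrightarrow>
     s = s' \<and> i' = hub_group s i j \<and> i < D \<and> j < D \<and> k < D"
  "{link_vertex s' i j, hub_vertex s i' k} \<in> edges (grid_cover D) \<longleftrightarrow>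
     s = s' \<and> i' = hub_group s i j \<and> i < D \<and> j < D \<and> k < D"
  by (auto simp: grid_cover_def doubleton_eq_iff)

lemma card_hubs: "card (hubs D s) = D ^ 2"
proof -
  have "hubs D s = (\<lambda>(i, k). hub_vertex s i k) ` ({..<D} \<times> {..<D})"
    by (auto simp: hubs_def)
  moreover have "inj_on (\<lambda>(i, k). hub_vertex s i k) ({..<D} \<times> {..<D})"
    by (auto simp: inj_on_def)
  ultimately show ?thesis
    by (simp add: card_image card_cartesian_product power2_eq_square)
qed

lemma links_eq: "links i j = {link_vertex False i j, link_vertex True i j}"
proof (intro set_eqI iffI)
  fix x assume "x \<in> links i j"
  then obtain s where "x = link_vertex s i j"
    by (auto simp: links_def)
  then show "x \<in> {link_vertex False i j, link_vertex True i j}"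
    by (cases s) auto
qed (auto simp: links_def)

lemma neighbours_hub:
  assumes "i < D" "k < D"
  shows "neighbours (grid_cover D) (hub_vertex s i k) =
           (\<lambda>j. if s then link_vertex s j i else link_vertex s i j) ` {..<D}"
proof (intro set_eqI iffI)
  fix u assume "u \<in> neighbours (grid_cover D) (hub_vertex s i k)"
  then show "u \<in> (\<lambda>j. if s then link_vertex s j i else link_vertex s i j) ` {..<D}"
    by (cases s) (auto simp: neighbours_def grid_cover_def doubleton_eq_iff hub_group_def)
next
  fix u assume "u \<in> (\<lambda>j. if s then link_vertex s j i else link_vertex s i j) ` {..<D}"
  then show "u \<in> neighbours (grid_cover D) (hub_vertex s i k)"
    using assms
    by (auto simp: neighbours_def grid_cover_edge_iff hub_group_def split: if_splits)
qed

lemma neighbours_link: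
  assumes "i < D" "j < D"
  shows "neighbours (grid_cover D) (link_vertex s i j) =
           (\<lambda>k. hub_vertex s (hub_group s i j) k) ` {..<D}"
proof (intro set_eqI iffI)
  fix u assume "u \<in> neighbours (grid_cover D) (link_vertex s i j)"
  then show "u \<in> (\<lambda>k. hub_vertex s (hub_group s i j) k) ` {..<D}"
    by (auto simp: neighbours_def grid_cover_def doubleton_eq_iff)
next
  fix u assume "u \<in> (\<lambda>k. hub_vertex s (hub_group s i j) k) ` {..<D}"
  then show "u \<in> neighbours (grid_cover D) (link_vertex s i j)"
    using assms by (auto simp: neighbours_def grid_cover_edge_iff)
qed

lemma grid_cover_max_degree:
  assumes "D \<ge> 1"
  shows "has_max_degree (grid_cover D) D"
proof -
  have deg: "finite (neighbours (grid_cover D) v) \<and> card (neighbours (grid_cover D) v) = D"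
    if "v \<in> verts (grid_cover D)" for v
  proof -
    from that consider s i k where "v = hub_vertex s i k" "i < D" "k < D"
      | s i j where "v = link_vertex s i j" "i < D" "j < D"
      by (auto simp: grid_cover_def hubs_def)
    then show ?thesis
    proof cases
      case 1
      then show ?thesis
        by (cases s) (simp_all add: neighbours_hub card_image inj_on_def)
    next
      case 2
      then show ?thesis
        by (simp add: neighbours_link card_image inj_on_def)
    qed
  qed
  have v: "link_vertex False 0 0 \<in> verts (grid_cover D)"
    using assms by (auto simp: grid_cover_def)
  show ?thesis
    unfolding has_max_degree_def
  proof (intro conjI ballI disjI1)
    show "\<exists>v\<in>verts (grid_cover D). card (neighbours (grid_cover D) v) = D"
      using deg[OF v] v by blast
  qed (simp_all add: deg)
qed

lemma bipartiteI:
  assumes "A \<union> B = verts G" "A \<inter> B = {}"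
    and edge: "\<And>e. e \<in> edges G \<Longrightarrow> \<exists>a\<in>A. \<exists>b\<in>B. e = {a, b}"
  shows "bipartite G A B"
proof -
  have "e \<subseteq> verts G \<and> card e = 2" if "e \<in> edges G" for e
  proof -
    from edge[OF that] obtain a b where "a \<in> A" "b \<in> B" "e = {a, b}"
      by blast
    moreover from this have "a \<noteq> b"
      using assms(2) by blast
    ultimately show ?thesis
      using assms(1) by auto
  qed
  then show ?thesis
    unfolding bipartite_def simple_graph_def using assms by blast
qed

lemma partitions_Un:
  assumes I: "partitions L I S" and J: "partitions L J T" and "S \<inter> T = {}"
  shows "partitions L (I \<union> J) (S \<union> T)"
proof -
  have sub: "L v \<subseteq> S" if "v \<in> I" for v
    using I that unfolding partitions_def by blast
  have sub': "L v \<subseteq> T" if "v \<in> J" for v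
    using J that unfolding partitions_def by blast
  have "L v \<inter> L v' = {}" if "v \<in> I" "v' \<in> J" for v v'
    using sub[OF that(1)] sub'[OF that(2)] assms(3) by blast
  moreover have "disjoint_family_on L I" "disjoint_family_on L J"
    using I J unfolding partitions_def by blast+
  ultimately have "disjoint_family_on L (I \<union> J)"
    unfolding disjoint_family_on_def by (metis Un_iff Int_commute)
  then show ?thesis
    using I J unfolding partitions_def by (simp add: ball_Un UN_Un)
qed

lemma grid_cover_bipartite_cover:
  assumes "D \<ge> 1"
  shows "bipartite_cover (grid_base D)
           (range (\<lambda>s. hub_vertex s 0 0)) {link_vertex False i j | i j. i < D \<and> j < D}
           (grid_cover D) (\<Union>s. hubs D s) {link_vertex s i j | s i j. i < D \<and> j < D}
           (grid_part D)"
    (is "bipartite_cover _ ?A ?B _ ?A' ?B' _")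
proof -
  have base: "bipartite (grid_base D) ?A ?B"
    by (rule bipartiteI) (auto simp: grid_base_def)
  have cover: "bipartite (grid_cover D) ?A' ?B'"
  proof (rule bipartiteI)
    fix e assume "e \<in> edges (grid_cover D)"
    then obtain s i j k where ijk: "i < D" "j < D" "k < D"
      and e: "e = {hub_vertex s (hub_group s i j) k, link_vertex s i j}"
      by (auto simp: grid_cover_def)
    have "hub_vertex s (hub_group s i j) k \<in> ?A'"
      using ijk hub_group_less by (auto simp: hubs_def)
    moreover have "link_vertex s i j \<in> ?B'"
      using ijk by auto
    ultimately show "\<exists>a\<in>?A'. \<exists>b\<in>?B'. e = {a, b}"
      using e by blast
  qed (auto simp: grid_cover_def hubs_def)
  have hub0: "hub_vertex s 0 0 \<in> hubs D s" for s
    using assms by (auto simp: hubs_def)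
  have ne: "hubs D s \<noteq> {}" for s
    using hub0[of s] by blast
  have A: "partitions (grid_part D) ?A ?A'"
    unfolding partitions_def disjoint_family_on_def 
  proof (intro conjI ballI impI)
    show "grid_part D v \<noteq> {}" if "v \<in> ?A" for v
      using that ne by auto
  qed (auto simp: hubs_def)
  have B: "partitions (grid_part D) ?B ?B'"
    unfolding partitions_def disjoint_family_on_def
  proof (intro conjI ballI impI)
    show "(\<Union>w\<in>?B. grid_part D w) = ?B'"
    proof (intro subset_antisym subsetI)
      fix x assume "x \<in> ?B'"
      then obtain s i j where "i < D" "j < D" "x = link_vertex s i j"
        by blast
      then have "link_vertex False i j \<in> ?B" "x \<in> grid_part D (link_vertex False i j)"
        by (auto simp: links_def)
      then show "x \<in> (\<Union>w\<in>?B. grid_part D w)"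
        by blast
    qed (auto simp: links_def)
  qed (auto simp: links_eq)
  have "partitions (grid_part D) (?A \<union> ?B) (?A' \<union> ?B')"
    by (rule partitions_Un[OF A B]) (auto simp: hubs_def)
  then have AB: "partitions (grid_part D) (verts (grid_base D)) (verts (grid_cover D))"
    by (simp add: grid_base_def grid_cover_def)
  have "{v, v'} \<in> edges (grid_base D)"
    if v: "v \<in> verts (grid_base D)" "v' \<in> verts (grid_base D)"
      and x: "x \<in> grid_part D v" "y \<in> grid_part D v'" and e: "{x, y} \<in> edges (grid_cover D)"
    for v v' x y
  proof -
    have hub: "v = hub_vertex s 0 0"
      if "v \<in> verts (grid_base D)" "hub_vertex s i k \<in> grid_part D v" for v s i k
      using that by (auto simp: grid_base_def hubs_def links_def)
    have link: "v = link_vertex False i j"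
      if "v \<in> verts (grid_base D)" "link_vertex s i j \<in> grid_part D v" for v s i j
      using that by (auto simp: grid_base_def hubs_def links_def)
    obtain s i j k where "i < D" "j < D"
      and "{x, y} = {hub_vertex s (hub_group s i j) k, link_vertex s i j}"
      using e by (auto simp: grid_cover_def)
    then have "{v, v'} = {hub_vertex s 0 0, link_vertex False i j}"
      using hub link v x by (auto simp: doubleton_eq_iff)
    with \<open>i < D\<close> \<open>j < D\<close> show ?thesis
      by (auto simp: grid_base_def)
  qed
  then have "cover (grid_base D) (grid_cover D) (grid_part D)"
    unfolding cover_def using AB by blast
  then show ?thesis
    unfolding bipartite_cover_def using base cover A B by blast
qed

text \<open>A transversal chooses a vertex in some group \<open>i False\<close> of one large part and in some group
  \<open>i True\<close> of the other. The small part for this pair of groups is then completely blocked: each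
  of its two vertices is adjacent to one of the chosen groups as a whole.\<close>

lemma grid_cover_no_independent_transversal:
  "\<nexists>T. independent_transversal (grid_base D) (grid_cover D) (grid_part D) T"
proof
  assume "\<exists>T. independent_transversal (grid_base D) (grid_cover D) (grid_part D) T"
  then obtain T where T: "independent_transversal (grid_base D) (grid_cover D) (grid_part D) T" ..
  have indep: "{x, y} \<notin> edges (grid_cover D)" if "x \<in> T" "y \<in> T" for x y
    using T that unfolding independent_transversal_def independent_set_def by simp
  have meets: "\<exists>x. x \<in> T \<inter> grid_part D v" if "v \<in> verts (grid_base D)" for v
    using T that unfolding independent_transversal_def by (elim conjE ballE ex1E) auto
  have "\<forall>s. \<exists>i k. i < D \<and> k < D \<and> hub_vertex s i k \<in> T"
  proof
    fix s
    have "hub_vertex s 0 0 \<in> verts (grid_base D)"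
      by (auto simp: grid_base_def)
    from meets[OF this] show "\<exists>i k. i < D \<and> k < D \<and> hub_vertex s i k \<in> T"
      by (auto simp: hubs_def)
  qed
  then obtain i k where ik: "i s < D" "k s < D" "hub_vertex s (i s) (k s) \<in> T" for s
    by metis
  have "link_vertex False (i False) (i True) \<in> verts (grid_base D)"
    using ik by (auto simp: grid_base_def)
  from meets[OF this] obtain s where s: "link_vertex s (i False) (i True) \<in> T"
    by (auto simp: links_def)
  have "i s = hub_group s (i False) (i True)"
    by (cases s) (simp_all add: hub_group_def)
  then have "{hub_vertex s (i s) (k s), link_vertex s (i False) (i True)}
      \<in> edges (grid_cover D)"
    using ik by (simp add: grid_cover_edge_iff)
  with indep[OF ik(3) s] show False
    by blast
qed

lemma grid_cover_finite: "finite (verts (grid_base D))" "finite (verts (grid_cover D))"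
proof -
  have fin: "finite {f i j | i j. i < D \<and> j < D}" for f :: "nat \<Rightarrow> nat \<Rightarrow> nat"
    by (rule finite_image_set2) simp_all
  show "finite (verts (grid_base D))"
    by (simp add: grid_base_def fin)
  have "{link_vertex s i j | s i j. i < D \<and> j < D} =
      (\<Union>s. {link_vertex s i j | i j. i < D \<and> j < D})"
    by blast
  then show "finite (verts (grid_cover D))"
    by (simp add: grid_cover_def hubs_def fin)
qed

text \<open>A hub vertex sees only links of its own side, and the two links of a small part have opposite
  sides.\<close>

lemma no_common_hub_neighbour:
  assumes "\<forall>b\<in>links i j. {hub_vertex s i' k, b} \<in> edges (grid_cover D)"
  shows False
proof -
  have "link_vertex (\<not> s) i j \<in> links i j"
    by (auto simp: links_def)
  with assms have "{hub_vertex s i' k, link_vertex (\<not> s) i j} \<in> edges (grid_cover D)"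
    by blast
  then show False
    by (simp add: grid_cover_edge_iff)
qed

lemma hubs_of_order_square_insufficient:
  assumes "D \<ge> 1"
  shows "\<exists>(G :: nat ugraph) A\<^sub>G B\<^sub>G (H :: nat ugraph) A\<^sub>H B\<^sub>H L.
          finite (verts G) \<and> finite (verts H) \<and>
          bipartite_cover G A\<^sub>G B\<^sub>G H A\<^sub>H B\<^sub>H L \<and>
          has_max_degree H D \<and>
          (\<forall>v\<in>A\<^sub>G. card (L v) \<ge> D ^ 2) \<and>
          (\<forall>w\<in>B\<^sub>G. card (L w) = 2) \<and>
          \<not> (\<exists>w\<in>B\<^sub>G. \<exists>a\<in>A\<^sub>H. \<forall>b\<in>L w. {a, b} \<in> edges H) \<and>
          \<not> (\<exists>T. independent_transversal G H L T)"
proof (intro exI conjI)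
  show "bipartite_cover (grid_base D)
          (range (\<lambda>s. hub_vertex s 0 0)) {link_vertex False i j | i j. i < D \<and> j < D}
          (grid_cover D) (\<Union>s. hubs D s) {link_vertex s i j | s i j. i < D \<and> j < D}
          (grid_part D)"
    using assms by (rule grid_cover_bipartite_cover)
  show "has_max_degree (grid_cover D) D"
    using assms by (rule grid_cover_max_degree)
  show "\<forall>v\<in>range (\<lambda>s. hub_vertex s 0 0). card (grid_part D v) \<ge> D ^ 2"
    by (auto simp: card_hubs)
  show "\<forall>w\<in>{link_vertex False i j | i j. i < D \<and> j < D}. card (grid_part D w) = 2"
    by (auto simp: links_eq)
  show "\<not> (\<exists>w\<in>{link_vertex False i j | i j. i < D \<and> j < D}. \<exists>a\<in>(\<Union>s. hubs D s).
           \<forall>b\<in>grid_part D w. {a, b} \<in> edges (grid_cover D))"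
  proof
    assume "\<exists>w\<in>{link_vertex False i j | i j. i < D \<and> j < D}. \<exists>a\<in>(\<Union>s. hubs D s).
              \<forall>b\<in>grid_part D w. {a, b} \<in> edges (grid_cover D)"
    then obtain i j a s where "a \<in> hubs D s"
        "\<forall>b\<in>grid_part D (link_vertex False i j). {a, b} \<in> edges (grid_cover D)"
      by blast
    moreover from this obtain i' k where "a = hub_vertex s i' k"
      unfolding hubs_def by blast
    ultimately show False
      using no_common_hub_neighbour by simp
  qed
qed (fact grid_cover_finite grid_cover_no_independent_transversal)+

section \<open>Sufficiency of \<open>2 * D\<^sup>2\<close> and insufficiency of \<open>D\<^sup>2\<close>\<close>

theorem proposition7:
  shows
    "(\<forall>(G :: 'a ugraph) A\<^sub>G B\<^sub>G (H :: 'b ugraph) A\<^sub>H B\<^sub>H L (D :: nat).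
        bipartite_cover G A\<^sub>G B\<^sub>G H A\<^sub>H B\<^sub>H L \<and>
        has_max_degree H D \<and>
        (\<forall>v\<in>A\<^sub>G. finite (L v) \<longrightarrow> card (L v) \<ge> 2 * D ^ 2) \<and>
        (\<forall>w\<in>B\<^sub>G. card (L w) = 2) \<and>
        \<not> (\<exists>w\<in>B\<^sub>G. \<exists>a\<in>A\<^sub>H. \<forall>b\<in>L w. {a, b} \<in> edges H)
        \<longrightarrow> (\<exists>T. independent_transversal G H L T))
     \<and>
     (\<forall>D::nat. D \<ge> 1 \<longrightarrow>
        (\<exists>(G :: nat ugraph) A\<^sub>G B\<^sub>G (H :: nat ugraph) A\<^sub>H B\<^sub>H L.
          finite (verts G) \<and> finite (verts H) \<and>
          bipartite_cover G A\<^sub>G B\<^sub>G H A\<^sub>H B\<^sub>H L \<and>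
          has_max_degree H D \<and>
          (\<forall>v\<in>A\<^sub>G. card (L v) \<ge> D ^ 2) \<and>
          (\<forall>w\<in>B\<^sub>G. card (L w) = 2) \<and>
          \<not> (\<exists>w\<in>B\<^sub>G. \<exists>a\<in>A\<^sub>H. \<forall>b\<in>L w. {a, b} \<in> edges H) \<and>
          \<not> (\<exists>T. independent_transversal G H L T)))"
proof (intro conjI allI impI)
  fix G :: "'a ugraph" and A\<^sub>G B\<^sub>G and H :: "'b ugraph" and A\<^sub>H B\<^sub>H L and D :: nat
  assume hyps: "bipartite_cover G A\<^sub>G B\<^sub>G H A\<^sub>H B\<^sub>H L \<and>
        has_max_degree H D \<and>
        (\<forall>v\<in>A\<^sub>G. finite (L v) \<longrightarrow> card (L v) \<ge> 2 * D ^ 2) \<and>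
        (\<forall>w\<in>B\<^sub>G. card (L w) = 2) \<and>
        \<not> (\<exists>w\<in>B\<^sub>G. \<exists>a\<in>A\<^sub>H. \<forall>b\<in>L w. {a, b} \<in> edges H)"
  have "2 * D ^ 2 \<le> card (L v)" if "v \<in> A\<^sub>G" "finite (L v)" for v
    using hyps that by simp
  moreover have "card (L w) = 2" if "w \<in> B\<^sub>G" for w
    using hyps that by simp
  ultimately show "\<exists>T. independent_transversal G H L T"
    using hyps bipartite_cover_independent_transversal[of G A\<^sub>G B\<^sub>G H A\<^sub>H B\<^sub>H L D] by simp
qed (rule hubs_of_order_square_insufficient)

end
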